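(* Let $N\ge4$ and suppose $X_1,\dots,X_N$ are matrices in $\mathbb{R}^{d\times d}$ satisfying $\frac1N\sum_{i=1}^NX_i=0$. Let $Z_1,\dots,Z_n$, where $n\le N$, be uniformly sampled from $X_1,\dots,X_N$ without replacement. Then $$\mathbb{E}\left[\bigg\|\frac1n\sum_{i=1}^nZ_i\bigg\|_F^2\right]=\frac1n\left(1-\frac{n-1}{N-1}\right)\mathbb{E}\left[\|Z_1\|_F^2\right],$$ $$\mathbb{E}\left[\bigg\|\frac1n\sum_{i=1}^nZ_i\bigg\|_F^4\right]=\frac1{n^4}\left(r_1\mathbb{E}\left[\|Z_1\|_F^4\right]+r_2\mathbb{E}\left[\langle Z_1,Z_2\rangle^2\right]+r_3\mathbb{E}\left[\|Z_1\|_F^2\|Z_2\|_F^2\right]\right),$$ where $$r_1=n\left(1-4\cdot\frac{n-1}{N-1}+6\cdot\frac{(n-1)(n-2)}{(N-1)(N-2)}-3\cdot\frac{(n-1)(n-2)(n-3)}{(N-1)(N-2)(N-3)}\right),$$ $$r_2=n(n-1)\left(2-4\cdot\frac{n-2}{N-2}+2\cdot\frac{(n-2)(n-3)}{(N-2)(N-3)}\right),$$ $$r_3=n(n-1)\left(1-2\cdot\frac{n-2}{N-2}+\frac{(n-2)(n-3)}{(N-2)(N-3)}\right).$$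
   Context: $\langle A,B\rangle=\mathrm{trace}(A^TB)$ and $\|A\|_F^2=\langle A,A\rangle$. Sampling without replacement means $Z_j=X_{\pi(j)}$ for a uniformly random permutation $\pi$ of $\{1,\dots,N\}$ (so $Z_1,Z_2$ are the first two draws; for $n=1$ the coefficients $r_2,r_3$ vanish). *)

theory Defs
  imports "HOL-Probability.Probability" "HOL-Combinatorics.Permutations"
begin

definition frob_inner :: "real ^ 'd ^ 'd \<Rightarrow> real ^ 'd ^ 'd \<Rightarrow> real" where
  "frob_inner A B = trace (transpose A ** B)"

definition frob_norm :: "real ^ 'd ^ 'd \<Rightarrow> real" where
  "frob_norm A = sqrt (frob_inner A A)"

text \<open>These are the inner product and norm that the library puts on iterated vector types.\<close>

lemma frob_inner_eq_inner: "frob_inner A B = A \<bullet> B"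
  unfolding frob_inner_def trace_def transpose_def matrix_matrix_mult_def inner_vec_def
  by (simp, rule sum.swap)

lemma frob_norm_eq_norm: "frob_norm A = norm A"
  by (simp add: frob_norm_def frob_inner_eq_inner norm_eq_sqrt_inner)

definition random_perm :: "nat \<Rightarrow> (nat \<Rightarrow> nat) pmf" where
  "random_perm N = pmf_of_set {\<pi>. \<pi> permutes {1..N}}"

text \<open>For \<open>n \<le> N\<close>, the joint distribution of \<open>draw X \<pi> 1, \<dots>, draw X \<pi> n\<close> with \<open>\<pi>\<close> drawn from
  \<open>random_perm N\<close> is that of a uniform sample without replacement from \<open>X 1, \<dots>, X N\<close>.\<close>

definition draw :: "(nat \<Rightarrow> 'a) \<Rightarrow> (nat \<Rightarrow> nat) \<Rightarrow> nat \<Rightarrow> 'a" where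
  "draw X \<pi> j = X (\<pi> j)"

abbreviation perm_expectation :: "nat \<Rightarrow> ((nat \<Rightarrow> nat) \<Rightarrow> real) \<Rightarrow> real" where
  "perm_expectation N f \<equiv> measure_pmf.expectation (random_perm N) f"

text \<open>The subtractions below are on reals, not truncated subtractions on naturals.\<close>

definition coeff_r1 :: "nat \<Rightarrow> nat \<Rightarrow> real" where
  "coeff_r1 N n = (let n = real n; N = real N in
     n * (1 - 4 * ((n - 1) / (N - 1))
            + 6 * (((n - 1) * (n - 2)) / ((N - 1) * (N - 2)))
            - 3 * (((n - 1) * (n - 2) * (n - 3)) / ((N - 1) * (N - 2) * (N - 3)))))"

definition coeff_r2 :: "nat \<Rightarrow> nat \<Rightarrow> real" where
  "coeff_r2 N n = (let n = real n; N = real N in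
     n * (n - 1) * (2 - 4 * ((n - 2) / (N - 2))
                      + 2 * (((n - 2) * (n - 3)) / ((N - 2) * (N - 3)))))"

definition coeff_r3 :: "nat \<Rightarrow> nat \<Rightarrow> real" where
  "coeff_r3 N n = (let n = real n; N = real N in
     n * (n - 1) * (1 - 2 * ((n - 2) / (N - 2))
                      + ((n - 2) * (n - 3)) / ((N - 2) * (N - 3))))"

end

theory Submission
  imports Defs
begin

text \<open>Write \<open>Z\<^sub>i\<close> for the \<open>i\<close>-th draw and \<open>S\<^sub>n\<close> for the sum of the first \<open>n\<close> draws. Sampling without
  replacement from a population that sums to zero has one linear property from which both moments
  follow: given the first \<open>m\<close> draws, every later draw has the same conditional mean, and since all
  \<open>N\<close> draws sum to zero this mean is \<open>- S\<^sub>m / (N - m)\<close>. Hence for \<open>n \<ge> m\<close> the conditional mean of \<open>S\<^sub>n\<close> is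
  \<open>(N - n) / (N - m) *\<^sub>R S\<^sub>m\<close>. The lemmas \<open>expectation_inner_next_draw\<close> and
  \<open>expectation_inner_sum_contract\<close> state the two facts without conditional expectations, by
  pairing with an arbitrary weight \<open>w\<close> that ignores all but the first \<open>m\<close> draws.

  The second moment is \<open>E (S\<^sub>n \<bullet> S\<^sub>n) = n E (S\<^sub>n \<bullet> Z\<^sub>1)\<close> by exchangeability, and now \<open>S\<^sub>n\<close> occurs
  linearly, paired with the weight \<open>Z\<^sub>1\<close>. For the fourth moment the factors \<open>S\<^sub>n\<close> of
  \<open>(S\<^sub>n \<bullet> S\<^sub>n) (S\<^sub>n \<bullet> S\<^sub>n)\<close> are expanded one at a time. Each expansion keeps apart only the terms in
  which the new index equals an earlier one, because all new indices contribute equally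
  (\<open>expectation_inner_sum_exchange\<close>). Once a single factor \<open>S\<^sub>n\<close> is left, the linear property
  removes it. What remains are mixed moments of at most three draws, and the same property reduces
  those to the three moments in the claim. This avoids splitting the sum over four indices into its
  fifteen coincidence patterns. Nothing is special to matrices: the argument works in every real
  inner product space.\<close>

section \<open>Exchangeability of the draws\<close>

text \<open>For a random variable on the space of orderings and finite \<open>A\<close>, this says that the draws at the
  positions in \<open>A\<close> matter only as an unordered collection. Functions of the draws outside \<open>A\<close> have
  this property, and so does the sum of a block of draws that contains \<open>A\<close>.\<close>
definition swap_invariant :: "nat set \<Rightarrow> ((nat \<Rightarrow> nat) \<Rightarrow> 'b) \<Rightarrow> bool" where
  "swap_invariant A w \<longleftrightarrow> (\<forall>a\<in>A. \<forall>b\<in>A. \<forall>\<pi>. w (\<pi> \<circ> Transposition.transpose a b) = w \<pi>)"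

lemma integrable_random_perm [simp, intro]:
  fixes f :: "(nat \<Rightarrow> nat) \<Rightarrow> real"
  shows "integrable (measure_pmf (random_perm N)) f"
proof -
  have "{\<pi>. \<pi> permutes {1..N}} \<noteq> {}"
    using permutes_id by blast
  then show ?thesis
    unfolding random_perm_def
    by (intro integrable_measure_pmf_finite) (simp add: finite_permutations)
qed

lemma perm_expectation_compose:
  assumes "\<sigma> permutes {1..N}"
  shows "perm_expectation N (\<lambda>\<pi>. f (\<pi> \<circ> \<sigma>)) = perm_expectation N f"
proof -
  let ?P = "{\<pi>. \<pi> permutes {1..N}}"
  have P: "?P \<noteq> {}" "finite ?P"
    using permutes_id by (blast, simp add: finite_permutations)
  have "sum f ?P = (\<Sum>\<pi>\<in>?P. f (\<pi> \<circ> \<sigma>))"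
    by (rule sum_permutations_compose_right [OF assms])
  then show ?thesis
    using P by (simp add: random_perm_def integral_pmf_of_set)
qed

lemma perm_expectation_swap:
  assumes "a \<in> {1..N}" and "b \<in> {1..N}"
  shows "perm_expectation N (\<lambda>\<pi>. f (\<pi> \<circ> Transposition.transpose a b)) = perm_expectation N f"
  by (rule perm_expectation_compose) (rule permutes_swap_id [OF assms])

lemma sum_draw_swap:
  fixes X :: "nat \<Rightarrow> 'a::comm_monoid_add"
  assumes "a \<in> {1..n}" and "b \<in> {1..n}"
  shows "(\<Sum>i=1..n. draw X (\<pi> \<circ> Transposition.transpose a b) i) = (\<Sum>i=1..n. draw X \<pi> i)"
  using sum.permute [OF permutes_swap_id [OF assms], of "draw X \<pi>"]
  by (simp add: draw_def o_def)

lemma swap_invariant_draw: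
  "j \<notin> A \<Longrightarrow> swap_invariant A (\<lambda>\<pi>. draw X \<pi> j)"
  by (auto simp: swap_invariant_def draw_def Transposition.transpose_def)

lemma swap_invariant_sum_draws:
  fixes X :: "nat \<Rightarrow> 'a::comm_monoid_add"
  shows "A \<subseteq> {1..n} \<Longrightarrow> swap_invariant A (\<lambda>\<pi>. \<Sum>i=1..n. draw X \<pi> i)"
  unfolding swap_invariant_def using sum_draw_swap by blast

lemma swap_invariant_inner:
  "swap_invariant A f \<Longrightarrow> swap_invariant A g \<Longrightarrow> swap_invariant A (\<lambda>\<pi>. f \<pi> \<bullet> g \<pi>)"
  by (simp add: swap_invariant_def)

lemma swap_invariant_scaleR:
  "swap_invariant A f \<Longrightarrow> swap_invariant A g \<Longrightarrow> swap_invariant A (\<lambda>\<pi>. f \<pi> *\<^sub>R g \<pi>)"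
  by (simp add: swap_invariant_def)

text \<open>Swapping the positions \<open>m + 1\<close> and \<open>i\<close> preserves the uniform distribution and the weight, and
  it turns the draw at \<open>i\<close> into the draw at \<open>m + 1\<close>. So all summands beyond the first \<open>m\<close> have
  equal expectation. The weight may itself contain the sample sum, which is what allows the factors
  of a power of the sum to be expanded in turn.\<close>
lemma expectation_inner_sum_exchange:
  fixes X :: "nat \<Rightarrow> 'a::real_inner" and w :: "(nat \<Rightarrow> nat) \<Rightarrow> 'a"
  assumes "m \<le> n" and "n \<le> N" and w: "swap_invariant {m+1..n} w"
  shows "perm_expectation N (\<lambda>\<pi>. w \<pi> \<bullet> (\<Sum>i=1..n. draw X \<pi> i))
       = (\<Sum>i=1..m. perm_expectation N (\<lambda>\<pi>. w \<pi> \<bullet> draw X \<pi> i))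
         + real (n - m) * perm_expectation N (\<lambda>\<pi>. w \<pi> \<bullet> draw X \<pi> (m+1))"
proof -
  let ?E = "\<lambda>i. perm_expectation N (\<lambda>\<pi>. w \<pi> \<bullet> draw X \<pi> i)"
  have same: "?E i = ?E (m+1)" if i: "i \<in> {m+1..n}" for i
  proof -
    have "?E i = perm_expectation N (\<lambda>\<pi>. w (\<pi> \<circ> Transposition.transpose (m+1) i)
                                            \<bullet> draw X (\<pi> \<circ> Transposition.transpose (m+1) i) i)"
      by (rule perm_expectation_swap [symmetric]) (use i \<open>n \<le> N\<close> in auto)
    also have "\<dots> = ?E (m+1)"
      using w i by (simp add: swap_invariant_def draw_def)
    finally show ?thesis .
  qed
  have "{1..n} = {1..m} \<union> {m+1..n}"
    using \<open>m \<le> n\<close> by auto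
  then have "(\<Sum>i=1..n. ?E i) = (\<Sum>i=1..m. ?E i) + (\<Sum>i=m+1..n. ?E i)"
    by (simp add: sum.union_disjoint)
  also have "(\<Sum>i=m+1..n. ?E i) = real (n - m) * ?E (m+1)"
    using sum.cong [OF refl same, of "{m+1..n}"] by simp
  finally show ?thesis
    by (simp add: inner_sum_right)
qed

section \<open>Centred populations\<close>

text \<open>This is the exchange identity for the full sample, whose sum vanishes for every ordering.\<close>
lemma expectation_inner_next_draw:
  fixes X :: "nat \<Rightarrow> 'a::real_inner" and w :: "(nat \<Rightarrow> nat) \<Rightarrow> 'a"
  assumes X: "(\<Sum>i=1..N. X i) = 0" and "m < N" and w: "swap_invariant {m+1..N} w"
  shows "perm_expectation N (\<lambda>\<pi>. w \<pi> \<bullet> draw X \<pi> (m+1))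
       = - (\<Sum>i=1..m. perm_expectation N (\<lambda>\<pi>. w \<pi> \<bullet> draw X \<pi> i)) / (real N - real m)"
proof -
  have ne: "{\<pi>. \<pi> permutes {1..N}} \<noteq> {}"
    using permutes_id by blast
  have "(\<Sum>i=1..N. draw X \<pi> i) = 0" if "\<pi> \<in> set_pmf (random_perm N)" for \<pi>
    using that X sum.permute [of \<pi> "{1..N}" X] ne
    by (simp add: random_perm_def set_pmf_of_set finite_permutations draw_def o_def)
  then have "perm_expectation N (\<lambda>\<pi>. w \<pi> \<bullet> (\<Sum>i=1..N. draw X \<pi> i)) = 0"
    by (subst integral_cong_AE [where g = "\<lambda>_. 0"]) (auto simp: AE_measure_pmf_iff)
  with expectation_inner_sum_exchange [of m N N w X] assms show ?thesis
    by (simp add: of_nat_diff field_simps)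
qed

text \<open>For \<open>n < N\<close> this is the martingale property of the sums of the first \<open>n\<close> draws divided by
  \<open>N - n\<close>, tested against a weight that depends on the first \<open>m\<close> draws. The \<open>n - m\<close> later draws all
  pair with the weight like the next one, which is expressed through the first \<open>m\<close>.\<close>
lemma expectation_inner_sum_contract:
  fixes X :: "nat \<Rightarrow> 'a::real_inner" and w :: "(nat \<Rightarrow> nat) \<Rightarrow> 'a"
  assumes X: "(\<Sum>i=1..N. X i) = 0" and "m \<le> n" and "n \<le> N" and "m < N"
    and w: "swap_invariant {m+1..N} w"
  shows "perm_expectation N (\<lambda>\<pi>. w \<pi> \<bullet> (\<Sum>i=1..n. draw X \<pi> i))
       = (real N - real n) / (real N - real m)
         * (\<Sum>i=1..m. perm_expectation N (\<lambda>\<pi>. w \<pi> \<bullet> draw X \<pi> i))"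
proof -
  have "swap_invariant {m+1..n} w"
    using w \<open>n \<le> N\<close> by (auto simp: swap_invariant_def)
  note sample = expectation_inner_sum_exchange [OF \<open>m \<le> n\<close> \<open>n \<le> N\<close> this, of X]
  have "t + (b - c) * (- t / (a - c)) = (a - b) / (a - c) * t" if "a - c \<noteq> 0" for a b c t :: real
    using that by (simp add: field_simps)
  from this [of "real N" "real m" _ "real n"] show ?thesis
    unfolding sample expectation_inner_next_draw [OF X \<open>m < N\<close> w] of_nat_diff [OF \<open>m \<le> n\<close>]
    using \<open>m < N\<close> by simp
qed

section \<open>Moments of the sample sum\<close>

lemma second_moment_sum_draws:
  fixes X :: "nat \<Rightarrow> 'a::real_inner"
  assumes X: "(\<Sum>i=1..N. X i) = 0" and n: "1 \<le> n" "n \<le> N" and "2 \<le> N"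
  shows "perm_expectation N (\<lambda>\<pi>. norm (\<Sum>i=1..n. draw X \<pi> i) ^ 2)
       = real n * ((real N - real n) / (real N - 1))
         * perm_expectation N (\<lambda>\<pi>. norm (draw X \<pi> 1) ^ 2)"
proof -
  define S where "S = (\<lambda>\<pi>. \<Sum>i=1..n. draw X \<pi> i)"
  have S: "swap_invariant {1..n} S"
    unfolding S_def by (rule swap_invariant_sum_draws) simp
  have "perm_expectation N (\<lambda>\<pi>. S \<pi> \<bullet> S \<pi>)
      = real n * perm_expectation N (\<lambda>\<pi>. S \<pi> \<bullet> draw X \<pi> 1)"
    using expectation_inner_sum_exchange [of 0 n N S X] S n by (simp add: S_def)
  also have "perm_expectation N (\<lambda>\<pi>. S \<pi> \<bullet> draw X \<pi> 1)
      = (real N - real n) / (real N - 1) * perm_expectation N (\<lambda>\<pi>. draw X \<pi> 1 \<bullet> draw X \<pi> 1)"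
    using expectation_inner_sum_contract [of X N 1 n "\<lambda>\<pi>. draw X \<pi> 1"] assms
    by (simp add: swap_invariant_draw S_def inner_commute)
  finally show ?thesis
    by (simp add: S_def dot_square_norm mult.assoc)
qed

text \<open>The coefficients are polynomials in the ratios \<open>(n - k) / (N - k)\<close>, while contraction produces
  factors \<open>(N - n) / (N - k)\<close>; rewriting these as \<open>1 - (n - k) / (N - k)\<close> leaves a polynomial
  identity in \<open>n\<close> and the inverses of the \<open>N - k\<close>.\<close>
lemma fourth_moment_coefficients:
  fixes a b c :: real
  assumes "4 \<le> N"
  shows "real n *
     ((real N - real n) / (real N - 1) * a
      + (real n - 1) * ((real N - real n) / (real N - 2) * (b - a / (real N - 1)))
      + (real n - 1) *
        ((real N - real n) / (real N - 2) * (b - a / (real N - 1))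
         + (real N - real n) / (real N - 2) * (c - a / (real N - 1))
         + (real n - 2) * ((real N - real n) / (real N - 3)
             * (- (c - a / (real N - 1)) / (real N - 2)
                + 2 * (- (b - a / (real N - 1)) / (real N - 2))))))
   = coeff_r1 N n * a + coeff_r2 N n * b + coeff_r3 N n * c"
proof -
  have "real N - 1 \<noteq> 0" "real N - 2 \<noteq> 0" "real N - 3 \<noteq> 0"
    using assms by auto
  then have ratios: "(real N - real n) / (real N - 1) = 1 - (real n - 1) / (real N - 1)"
    "(real N - real n) / (real N - 2) = 1 - (real n - 2) / (real N - 2)"
    "(real N - real n) / (real N - 3) = 1 - (real n - 3) / (real N - 3)"
    by (simp_all add: field_simps)
  show ?thesis
    unfolding ratios coeff_r1_def coeff_r2_def coeff_r3_def Let_def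
    unfolding divide_inverse inverse_mult_distrib
    by algebra
qed

text \<open>The powers of \<open>S\<close> are removed in three stages: expansion of three of the four factors by
  exchangeability, removal of the last one by the contraction property, and reduction of the mixed
  moments in which some draw occurs only once. Splitting off two or three draws is possible only for
  samples that large; for smaller samples the corresponding terms carry a factor \<open>n - 1\<close> or
  \<open>n - 2\<close> that is zero.\<close>
lemma fourth_moment_sum_draws:
  fixes X :: "nat \<Rightarrow> 'a::real_inner"
  assumes X: "(\<Sum>i=1..N. X i) = 0" and n: "1 \<le> n" "n \<le> N" and N: "4 \<le> N"
  shows "perm_expectation N (\<lambda>\<pi>. norm (\<Sum>i=1..n. draw X \<pi> i) ^ 4)
       = coeff_r1 N n * perm_expectation N (\<lambda>\<pi>. norm (draw X \<pi> 1) ^ 4)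
       + coeff_r2 N n * perm_expectation N (\<lambda>\<pi>. (draw X \<pi> 1 \<bullet> draw X \<pi> 2) ^ 2)
       + coeff_r3 N n * perm_expectation N (\<lambda>\<pi>. norm (draw X \<pi> 1) ^ 2 * norm (draw X \<pi> 2) ^ 2)"
proof (cases "n = 1")
  case True
  then show ?thesis
    by (simp add: coeff_r1_def coeff_r2_def coeff_r3_def)
next
  case False
  with n have n2: "2 \<le> n" by simp
  define S where "S = (\<lambda>\<pi>. \<Sum>i=1..n. draw X \<pi> i)"
  define Z where "Z = (\<lambda>j \<pi>. draw X \<pi> j)"
  have Z: "draw X \<pi> j = Z j \<pi>" for \<pi> j by (simp add: Z_def)
  have S: "(\<Sum>i=1..n. Z i \<pi>) = S \<pi>" for \<pi> by (simp add: S_def Z_def)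
  let ?E = "perm_expectation N"
  let ?a = "?E (\<lambda>\<pi>. (Z 1 \<pi> \<bullet> Z 1 \<pi>) * (Z 1 \<pi> \<bullet> Z 1 \<pi>))"
  let ?b = "?E (\<lambda>\<pi>. (Z 1 \<pi> \<bullet> Z 2 \<pi>) * (Z 1 \<pi> \<bullet> Z 2 \<pi>))"
  let ?c = "?E (\<lambda>\<pi>. (Z 1 \<pi> \<bullet> Z 1 \<pi>) * (Z 2 \<pi> \<bullet> Z 2 \<pi>))"
  have Zswap: "Z j (\<pi> \<circ> Transposition.transpose k l) = Z (Transposition.transpose k l j) \<pi>" for j k l \<pi>
    by (simp add: Z_def draw_def)
  have inv: "j \<notin> A \<Longrightarrow> swap_invariant A (Z j)" "A \<subseteq> {1..n} \<Longrightarrow> swap_invariant A S" for j A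
    unfolding Z_def S_def by (fact swap_invariant_draw swap_invariant_sum_draws)+
  have sets: "{Suc 0..2} = {1,2}" "{Suc 0..3} = {1,2,3}"
    by auto
  note exchange = expectation_inner_sum_exchange [of _ n N _ X, unfolded Z, unfolded S]
  note contract = expectation_inner_sum_contract [of X N _ n, unfolded Z, unfolded S, OF X]
  note next_draw = expectation_inner_next_draw [of X N, unfolded Z, OF X]
  note invariance = numeral_2_eq_2 [symmetric] inv swap_invariant_inner swap_invariant_scaleR

  \<comment> \<open>Mixed moments are named by the indices of the four draws. A draw that occurs only once is
    summed out.\<close>
  have m1112: "?E (\<lambda>\<pi>. (Z 1 \<pi> \<bullet> Z 1 \<pi>) * (Z 1 \<pi> \<bullet> Z 2 \<pi>)) = - ?a / (real N - 1)"
    using next_draw [of 1 "\<lambda>\<pi>. (Z 1 \<pi> \<bullet> Z 1 \<pi>) *\<^sub>R Z 1 \<pi>"] N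
    by (simp add: invariance)
  have m2212: "?E (\<lambda>\<pi>. (Z 2 \<pi> \<bullet> Z 2 \<pi>) * (Z 1 \<pi> \<bullet> Z 2 \<pi>)) = - ?a / (real N - 1)"
    using perm_expectation_swap [of 1 N 2 "\<lambda>\<pi>. (Z 1 \<pi> \<bullet> Z 1 \<pi>) * (Z 1 \<pi> \<bullet> Z 2 \<pi>)"] m1112 N
    by (simp add: Zswap inner_commute)
  have m1123: "?E (\<lambda>\<pi>. (Z 1 \<pi> \<bullet> Z 1 \<pi>) * (Z 2 \<pi> \<bullet> Z 3 \<pi>))
         = - (?c - ?a / (real N - 1)) / (real N - 2)"
    using next_draw [of 2 "\<lambda>\<pi>. (Z 1 \<pi> \<bullet> Z 1 \<pi>) *\<^sub>R Z 2 \<pi>"] N m1112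
    by (simp add: invariance sets inner_commute)
  have m1223: "?E (\<lambda>\<pi>. (Z 1 \<pi> \<bullet> Z 2 \<pi>) * (Z 2 \<pi> \<bullet> Z 3 \<pi>))
         = - (?b - ?a / (real N - 1)) / (real N - 2)"
    using next_draw [of 2 "\<lambda>\<pi>. (Z 1 \<pi> \<bullet> Z 2 \<pi>) *\<^sub>R Z 2 \<pi>"] N m2212
    by (simp add: invariance sets inner_commute mult.commute)
  have m1323: "?E (\<lambda>\<pi>. (Z 1 \<pi> \<bullet> Z 3 \<pi>) * (Z 2 \<pi> \<bullet> Z 3 \<pi>))
         = - (?b - ?a / (real N - 1)) / (real N - 2)"
    using perm_expectation_swap [of 2 N 3 "\<lambda>\<pi>. (Z 1 \<pi> \<bullet> Z 2 \<pi>) * (Z 2 \<pi> \<bullet> Z 3 \<pi>)"] m1223 N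
    by (simp add: Zswap inner_commute)

  \<comment> \<open>Each step expands one factor \<open>S\<close>; the weight that is passed to the exchange identity is the rest of
    the product, so it may contain further factors \<open>S\<close>.\<close>
  have expand1: "?E (\<lambda>\<pi>. (S \<pi> \<bullet> S \<pi>) * (S \<pi> \<bullet> S \<pi>))
          = real n * ?E (\<lambda>\<pi>. (S \<pi> \<bullet> S \<pi>) * (S \<pi> \<bullet> Z 1 \<pi>))"
    using exchange [of 0 "\<lambda>\<pi>. (S \<pi> \<bullet> S \<pi>) *\<^sub>R S \<pi>"] n by (simp add: invariance)
  have expand2: "?E (\<lambda>\<pi>. (S \<pi> \<bullet> S \<pi>) * (S \<pi> \<bullet> Z 1 \<pi>))
          = ?E (\<lambda>\<pi>. (S \<pi> \<bullet> Z 1 \<pi>) * (S \<pi> \<bullet> Z 1 \<pi>))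
            + (real n - 1) * ?E (\<lambda>\<pi>. (S \<pi> \<bullet> Z 1 \<pi>) * (S \<pi> \<bullet> Z 2 \<pi>))"
    using exchange [of 1 "\<lambda>\<pi>. (S \<pi> \<bullet> Z 1 \<pi>) *\<^sub>R S \<pi>"] n
    by (simp add: invariance of_nat_diff mult.commute)
  have expand3: "?E (\<lambda>\<pi>. (S \<pi> \<bullet> Z 1 \<pi>) * (S \<pi> \<bullet> Z 1 \<pi>))
          = ?E (\<lambda>\<pi>. (Z 1 \<pi> \<bullet> Z 1 \<pi>) * (S \<pi> \<bullet> Z 1 \<pi>))
            + (real n - 1) * ?E (\<lambda>\<pi>. (Z 1 \<pi> \<bullet> Z 2 \<pi>) * (S \<pi> \<bullet> Z 1 \<pi>))"
    using exchange [of 1 "\<lambda>\<pi>. (S \<pi> \<bullet> Z 1 \<pi>) *\<^sub>R Z 1 \<pi>"] n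
    by (simp add: invariance of_nat_diff inner_commute mult.commute)
  have expand4: "?E (\<lambda>\<pi>. (S \<pi> \<bullet> Z 1 \<pi>) * (S \<pi> \<bullet> Z 2 \<pi>))
          = ?E (\<lambda>\<pi>. (Z 1 \<pi> \<bullet> Z 2 \<pi>) * (S \<pi> \<bullet> Z 1 \<pi>))
            + ?E (\<lambda>\<pi>. (Z 2 \<pi> \<bullet> Z 2 \<pi>) * (S \<pi> \<bullet> Z 1 \<pi>))
            + (real n - 2) * ?E (\<lambda>\<pi>. (Z 2 \<pi> \<bullet> Z 3 \<pi>) * (S \<pi> \<bullet> Z 1 \<pi>))"
    using exchange [of 2 "\<lambda>\<pi>. (S \<pi> \<bullet> Z 1 \<pi>) *\<^sub>R Z 2 \<pi>"] n n2
    by (simp add: invariance sets of_nat_diff inner_commute mult.commute)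

  \<comment> \<open>Now \<open>S\<close> occurs once in every expectation, paired with the weight to which it is contracted.\<close>
  have last1: "?E (\<lambda>\<pi>. (Z 1 \<pi> \<bullet> Z 1 \<pi>) * (S \<pi> \<bullet> Z 1 \<pi>))
          = (real N - real n) / (real N - 1) * ?a"
    using contract [of 1 "\<lambda>\<pi>. (Z 1 \<pi> \<bullet> Z 1 \<pi>) *\<^sub>R Z 1 \<pi>"] n N
    by (simp add: invariance inner_commute)
  have last2: "?E (\<lambda>\<pi>. (Z 1 \<pi> \<bullet> Z 2 \<pi>) * (S \<pi> \<bullet> Z 1 \<pi>))
          = (real N - real n) / (real N - 2) * (?b - ?a / (real N - 1))"
    using contract [of 2 "\<lambda>\<pi>. (Z 1 \<pi> \<bullet> Z 2 \<pi>) *\<^sub>R Z 1 \<pi>"] n N n2 m1112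
    by (simp add: invariance sets inner_commute mult.commute)
  have last3: "?E (\<lambda>\<pi>. (Z 2 \<pi> \<bullet> Z 2 \<pi>) * (S \<pi> \<bullet> Z 1 \<pi>))
          = (real N - real n) / (real N - 2) * (?c - ?a / (real N - 1))"
    using contract [of 2 "\<lambda>\<pi>. (Z 2 \<pi> \<bullet> Z 2 \<pi>) *\<^sub>R Z 1 \<pi>"] n N n2 m2212
    by (simp add: invariance sets inner_commute mult.commute)
  have last4: "(real n - 2) * ?E (\<lambda>\<pi>. (Z 2 \<pi> \<bullet> Z 3 \<pi>) * (S \<pi> \<bullet> Z 1 \<pi>))
          = (real n - 2) * ((real N - real n) / (real N - 3)
              * (- (?c - ?a / (real N - 1)) / (real N - 2)
                 + 2 * (- (?b - ?a / (real N - 1)) / (real N - 2))))"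
  \<comment> \<open>Contraction onto the first three draws needs a sample of size at least three.\<close>
  proof (cases "n = 2")
    case False
    with n2 have "3 \<le> n" by simp
    then show ?thesis
      using contract [of 3 "\<lambda>\<pi>. (Z 2 \<pi> \<bullet> Z 3 \<pi>) *\<^sub>R Z 1 \<pi>"] n N m1123 m1223 m1323
      by (simp add: invariance sets inner_commute mult.commute)
  qed simp

  have "?E (\<lambda>\<pi>. (S \<pi> \<bullet> S \<pi>) * (S \<pi> \<bullet> S \<pi>))
      = coeff_r1 N n * ?a + coeff_r2 N n * ?b + coeff_r3 N n * ?c"
    unfolding expand1 expand2 expand3 expand4 last1 last2 last3 last4
    by (rule fourth_moment_coefficients [OF N])
  moreover have "norm x ^ 4 = (x \<bullet> x) * (x \<bullet> x)" "norm x ^ 2 = x \<bullet> x" for x :: 'a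
    by (simp_all add: dot_square_norm power4_eq_xxxx power2_eq_square)
  ultimately show ?thesis
    unfolding S_def Z_def power2_eq_square [of "_ \<bullet> _"] by (simp only:)
qed

theorem lemma2p10:
  fixes X :: "nat \<Rightarrow> real ^ 'd ^ 'd" and N n :: nat
  assumes "N \<ge> 4" and "1 \<le> n" and "n \<le> N"
    and "(1 / real N) *\<^sub>R (\<Sum>i=1..N. X i) = 0"
  shows "perm_expectation N (\<lambda>\<pi>. frob_norm ((1 / real n) *\<^sub>R (\<Sum>i=1..n. draw X \<pi> i)) ^ 2)
           = 1 / real n * (1 - (real n - 1) / (real N - 1))
             * perm_expectation N (\<lambda>\<pi>. frob_norm (draw X \<pi> 1) ^ 2)
       \<and> perm_expectation N (\<lambda>\<pi>. frob_norm ((1 / real n) *\<^sub>R (\<Sum>i=1..n. draw X \<pi> i)) ^ 4)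
           = 1 / real n ^ 4
             * (coeff_r1 N n * perm_expectation N (\<lambda>\<pi>. frob_norm (draw X \<pi> 1) ^ 4)
              + coeff_r2 N n * perm_expectation N (\<lambda>\<pi>. frob_inner (draw X \<pi> 1) (draw X \<pi> 2) ^ 2)
              + coeff_r3 N n * perm_expectation N
                  (\<lambda>\<pi>. frob_norm (draw X \<pi> 1) ^ 2 * frob_norm (draw X \<pi> 2) ^ 2))"
proof (intro conjI)
  have X: "(\<Sum>i=1..N. X i) = 0"
    using assms by simp
  have scale: "perm_expectation N (\<lambda>\<pi>. norm ((1 / real n) *\<^sub>R f \<pi>) ^ k)
      = 1 / real n ^ k * perm_expectation N (\<lambda>\<pi>. norm (f \<pi>) ^ k)"
    for f :: "(nat \<Rightarrow> nat) \<Rightarrow> real ^ 'd ^ 'd" and k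
    by (simp add: power_mult_distrib power_divide)
  have "real N - 1 \<noteq> 0"
    using \<open>N \<ge> 4\<close> by simp
  then have rescale: "1 / real n ^ 2 * (real n * ((real N - real n) / (real N - 1)))
      = 1 / real n * (1 - (real n - 1) / (real N - 1))"
    using \<open>1 \<le> n\<close> by (simp add: field_simps power2_eq_square)
  have "2 \<le> N"
    using \<open>N \<ge> 4\<close> by simp
  show "perm_expectation N (\<lambda>\<pi>. frob_norm ((1 / real n) *\<^sub>R (\<Sum>i=1..n. draw X \<pi> i)) ^ 2)
      = 1 / real n * (1 - (real n - 1) / (real N - 1))
        * perm_expectation N (\<lambda>\<pi>. frob_norm (draw X \<pi> 1) ^ 2)"
    unfolding frob_norm_eq_norm scale rescale [symmetric]
      second_moment_sum_draws [OF X \<open>1 \<le> n\<close> \<open>n \<le> N\<close> \<open>2 \<le> N\<close>]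
    by (simp only: mult.assoc)
  show "perm_expectation N (\<lambda>\<pi>. frob_norm ((1 / real n) *\<^sub>R (\<Sum>i=1..n. draw X \<pi> i)) ^ 4)
      = 1 / real n ^ 4
        * (coeff_r1 N n * perm_expectation N (\<lambda>\<pi>. frob_norm (draw X \<pi> 1) ^ 4)
         + coeff_r2 N n * perm_expectation N (\<lambda>\<pi>. frob_inner (draw X \<pi> 1) (draw X \<pi> 2) ^ 2)
         + coeff_r3 N n * perm_expectation N
             (\<lambda>\<pi>. frob_norm (draw X \<pi> 1) ^ 2 * frob_norm (draw X \<pi> 2) ^ 2))"
    unfolding frob_norm_eq_norm frob_inner_eq_inner scale
      fourth_moment_sum_draws [OF X \<open>1 \<le> n\<close> \<open>n \<le> N\<close> \<open>N \<ge> 4\<close>] ..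
qed

end
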